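(* Let $a,b>0$ be integers, $Q(z)=(1+az)(1+bz)$, and let $(H_n(x))_{n\ge0}$ be the polynomials defined by $\sum_{n\ge 0}H_n(x)\frac{z^n}{n!}=Q(z)^xQ(-z)^{1-x}$. Consider the marked generating tree with root at level $0$ specified by $$\begin{cases}\text{root}: & (0)\\ \text{rule}: & (k)\rightarrow (0)^{p_{k,0}}(1)^{p_{k,1}}\cdots(k+1)^{p_{k,k+1}}\\ & (\overline{k})\rightarrow(\overline{0})^{p_{k,0}}(\overline{1})^{p_{k,1}}\cdots(\overline{k+1})^{p_{k,k+1}}\end{cases}$$ where $p_{k,j}=\frac{k!}{j!}\left(c_{k-j}+j\,r_{k-j+1}\right)$ and the sequences $(c_n)$, $(r_n)$ are given in the context. For $k=0,1,\ldots,n$, let $\mu_n(k)$ denote the number of (unmarked) nodes $(k)$ with label $k$ at level $n$, and $\mu_n(\overline{k})$ the number of marked nodes $(\overline{k})$ at level $n$. Then $$[x^k]H_n(x)=(-1)^{n+k}(2a+2b)^k\left(\mu_n(k)-\mu_n(\overline{k})\right).$$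
   Context: $[x^k]$ denotes extraction of the coefficient of $x^k$. Let $f(z)=\frac{1}{2(a+b)}\ln\frac{Q(z)}{Q(-z)}$ as a formal power series, and let $\overline{f}$ be its compositional inverse. The sequences $(c_n)_{n\ge0}$ and $(r_n)_{n\ge 0}$ are the coefficients of the power series $$\sum_{n\ge0}c_nz^n=\frac{a}{1+a\overline{f}(z)}+\frac{b}{1+b\overline{f}(z)},\qquad \sum_{n\ge0}r_nz^n=\frac{1}{a+b}\left(\frac{a}{1-(a\overline{f}(z))^2}+\frac{b}{1-(b\overline{f}(z))^2}\right),$$ with $c_i=r_i=0$ for $i<0$. The numbers $p_{k,j}$ are integers. A marked generating tree is a rooted labeled tree whose nodes carry labels $k\in\{0,1,2,\dots\}$ and are either unmarked, written $(k)$, or marked, written $(\overline{k})$; the production rule specifies the list of children of each node in terms of its label and whether it is marked. For an integer $p$: if $p>0$, $(k)^p$ stands for $p$ copies of $(k)$; if $p<0$, $(k)^p$ stands for $-p$ copies of the marked node $(\overline{k})$; $(k)^0$ is empty. The same convention applies to $(\overline{k})^p$ with $(\overline{\overline{k}})=(k)$, i.e. $p>0$ gives $p$ copies of $(\overline{k})$ and $p<0$ gives $-p$ copies of $(k)$. The root is a single unmarked node $(0)$ at level $0$; the children of nodes at level $n$ are at level $n+1$. *)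

theory Defs
  imports Complex_Main "HOL-Computational_Algebra.Computational_Algebra"
begin

subsection \<open>The power series\<close>

definition Q_fps :: "int \<Rightarrow> int \<Rightarrow> real fps" where
  "Q_fps a b = (1 + fps_const (of_int a) * fps_X) * (1 + fps_const (of_int b) * fps_X)"

definition Qm_fps :: "int \<Rightarrow> int \<Rightarrow> real fps" where
  "Qm_fps a b = Q_fps a b oo (- fps_X)"

text \<open>The formal power \<open>F(z)\<^sup>x\<close> and the formal logarithm \<open>ln F(z)\<close> of a series with constant
  term 1: the series of \<open>(1 + w)\<^sup>x\<close> resp. \<open>ln (1 + w)\<close> at \<open>w = F(z) - 1\<close>. Note that \<open>fps_ln c\<close>
  is the series of \<open>ln (1 + w) / c\<close>.\<close>

definition fps_pow :: "real fps \<Rightarrow> real \<Rightarrow> real fps" where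
  "fps_pow F x = fps_binomial x oo (F - 1)"

definition fps_log :: "real fps \<Rightarrow> real fps" where
  "fps_log F = fps_ln 1 oo (F - 1)"

definition f_fps :: "int \<Rightarrow> int \<Rightarrow> real fps" where
  "f_fps a b = fps_const (1 / (2 * (of_int a + of_int b))) * fps_log (Q_fps a b / Qm_fps a b)"

abbreviation fbar :: "int \<Rightarrow> int \<Rightarrow> real fps" where
  "fbar a b \<equiv> fps_inv (f_fps a b)"

definition c_fps :: "int \<Rightarrow> int \<Rightarrow> real fps" where
  "c_fps a b =
     fps_const (of_int a) / (1 + fps_const (of_int a) * fbar a b) +
     fps_const (of_int b) / (1 + fps_const (of_int b) * fbar a b)"

definition r_fps :: "int \<Rightarrow> int \<Rightarrow> real fps" where
  "r_fps a b = fps_const (1 / (of_int a + of_int b)) *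
     (fps_const (of_int a) / (1 - (fps_const (of_int a) * fbar a b)^2) +
      fps_const (of_int b) / (1 - (fps_const (of_int b) * fbar a b)^2))"

definition cseq :: "int \<Rightarrow> int \<Rightarrow> int \<Rightarrow> real" where
  "cseq a b i = (if i < 0 then 0 else fps_nth (c_fps a b) (nat i))"

definition rseq :: "int \<Rightarrow> int \<Rightarrow> int \<Rightarrow> real" where
  "rseq a b i = (if i < 0 then 0 else fps_nth (r_fps a b) (nat i))"

text \<open>The floor only converts the type: its argument is an integer for \<open>a, b > 0\<close>,
  see \<open>of_int_pcoeff\<close> below.\<close>

definition pcoeff :: "int \<Rightarrow> int \<Rightarrow> nat \<Rightarrow> nat \<Rightarrow> int" where
  "pcoeff a b k j =
     \<lfloor>fact k / fact j * (cseq a b (int k - int j) + real j * rseq a b (int k - int j + 1))\<rfloor>"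


subsection \<open>Marked generating trees\<close>

codatatype 'a ltree = Node (label: 'a) (children: "'a ltree list")

primcorec gen_tree :: "('a \<Rightarrow> 'a list) \<Rightarrow> 'a \<Rightarrow> 'a ltree" where
  "gen_tree rule x = Node x (map (gen_tree rule) (rule x))"

primrec level :: "nat \<Rightarrow> 'a ltree \<Rightarrow> 'a ltree list" where
  "level 0 t = [t]"
| "level (Suc n) t = concat (map (level n) (children t))"

text \<open>Each node of level \<open>n\<close> occupies exactly one position of the list \<open>level n t\<close>, so this
  counts nodes, even if the subtrees hanging from different nodes are equal.\<close>

definition num_nodes :: "nat \<Rightarrow> 'a \<Rightarrow> 'a ltree \<Rightarrow> nat" where
  "num_nodes n x t = length (filter (\<lambda>s. label s = x) (level n t))"

datatype mlabel = Unmarked nat | Marked nat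

fun flip_mark :: "mlabel \<Rightarrow> mlabel" where
  "flip_mark (Unmarked k) = Marked k"
| "flip_mark (Marked k) = Unmarked k"

definition copies :: "mlabel \<Rightarrow> int \<Rightarrow> mlabel list" where
  "copies v p = (if p \<ge> 0 then replicate (nat p) v else replicate (nat (- p)) (flip_mark v))"

fun marked_rule :: "(nat \<Rightarrow> nat \<Rightarrow> int) \<Rightarrow> mlabel \<Rightarrow> mlabel list" where
  "marked_rule p (Unmarked k) = concat (map (\<lambda>j. copies (Unmarked j) (p k j)) [0..<k+2])"
| "marked_rule p (Marked k) = concat (map (\<lambda>j. copies (Marked j) (p k j)) [0..<k+2])"

definition marked_tree :: "(nat \<Rightarrow> nat \<Rightarrow> int) \<Rightarrow> mlabel ltree" where
  "marked_tree p = gen_tree (marked_rule p) (Unmarked 0)"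


subsection \<open>Existence of the polynomials \<open>H\<^sub>n(x)\<close>\<close>

definition poly_coeffs :: "(real \<Rightarrow> real fps) \<Rightarrow> bool" where
  "poly_coeffs F \<longleftrightarrow> (\<forall>n. \<exists>p. \<forall>x. poly p x = fps_nth (F x) n)"

lemma poly_coeffs_mult:
  assumes "poly_coeffs F" "poly_coeffs G"
  shows "poly_coeffs (\<lambda>x. F x * G x)"
proof -
  from assms obtain p q where "\<And>n x. poly (p n) x = fps_nth (F x) n"
    "\<And>n x. poly (q n) x = fps_nth (G x) n"
    unfolding poly_coeffs_def by metis
  then have "\<forall>x. poly (\<Sum>i=0..n. p i * q (n - i)) x = fps_nth (F x * G x) n" for n
    by (simp add: poly_sum fps_mult_nth)
  then show ?thesis unfolding poly_coeffs_def by blast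
qed

lemma poly_coeffs_fps_pow: "poly_coeffs (fps_pow F)"
proof -
  have "\<forall>x. poly (\<Sum>i=0..n. smult (fps_nth ((F - 1) ^ i) n / fact i)
      (\<Prod>j=0..<i. [:- of_nat j, 1:])) x = fps_nth (fps_pow F x) n" for n
    by (simp add: fps_pow_def fps_compose_nth poly_sum poly_prod gbinomial_prod_rev
        mult.commute[of "fps_nth _ _"])
  then show ?thesis unfolding poly_coeffs_def by blast
qed

lemma H_exists:
  "\<exists>H :: nat \<Rightarrow> real poly. \<forall>x. Abs_fps (\<lambda>m. poly (H m) x / fact m) =
     fps_pow (Q_fps a b) x * fps_pow (Qm_fps a b) (1 - x)"
proof -
  have "poly_coeffs (\<lambda>x. fps_pow F (1 - x))" for F
  proof -
    obtain p where "\<And>n x. poly (p n) x = fps_nth (fps_pow F x) n"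
      using poly_coeffs_fps_pow unfolding poly_coeffs_def by metis
    then have "\<forall>x. poly (p n \<circ>\<^sub>p [:1, -1:]) x = fps_nth (fps_pow F (1 - x)) n" for n
      by (simp add: poly_pcompose)
    then show ?thesis unfolding poly_coeffs_def by blast
  qed
  from poly_coeffs_mult[OF poly_coeffs_fps_pow this] obtain p where
    "\<And>n x. poly (p n) x = fps_nth (fps_pow (Q_fps a b) x * fps_pow (Qm_fps a b) (1 - x)) n"
    unfolding poly_coeffs_def by metis
  then show ?thesis
    by (intro exI[of _ "\<lambda>n. smult (fact n) (p n)"]) (simp add: fps_eq_iff)
qed


subsection \<open>The numbers \<open>pcoeff a b k j\<close> are integers\<close>

definition int_coeffs :: "real fps \<Rightarrow> bool" where
  "int_coeffs F \<longleftrightarrow> (\<forall>n. fps_nth F n \<in> \<int>)"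

lemma int_coeffs_mult: "int_coeffs F \<Longrightarrow> int_coeffs G \<Longrightarrow> int_coeffs (F * G)"
  unfolding int_coeffs_def fps_mult_nth by (auto intro!: Ints_sum Ints_mult)

lemma int_coeffs_add: "int_coeffs F \<Longrightarrow> int_coeffs G \<Longrightarrow> int_coeffs (F + G)"
  unfolding int_coeffs_def by auto

lemma int_coeffs_deriv: "int_coeffs F \<Longrightarrow> int_coeffs (fps_deriv F)"
  unfolding int_coeffs_def by (auto intro!: Ints_mult Ints_add)

lemma int_coeffs_inverse:
  assumes "int_coeffs F" "fps_nth F 0 = 1"
  shows "int_coeffs (inverse F)"
proof -
  have "fps_nth (inverse F) n \<in> \<int>" for n
  proof (induction n rule: less_induct)
    case (less n)
    show ?case
    proof (cases n)
      case 0
      then show ?thesis using assms by simp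
    next
      case (Suc m)
      have "fps_nth (inverse F) n =
          - inverse (fps_nth F 0) * (\<Sum>i=1..n. fps_nth F i * fps_nth (inverse F) (n - i))"
        using Suc by (simp add: fps_inverse_def sum_distrib_left)
      also have "\<dots> \<in> \<int>"
        unfolding assms(2) using less assms(1) unfolding int_coeffs_def
        by (intro Ints_mult Ints_sum Ints_minus) auto
      finally show ?thesis .
    qed
  qed
  then show ?thesis by (simp add: int_coeffs_def)
qed

lemma fact_compose_Ints:
  assumes "fps_nth \<phi> 0 = 0" "fps_deriv \<phi> = g oo \<phi>" "int_coeffs g" "int_coeffs h"
  shows "fact n * fps_nth (h oo \<phi>) n \<in> \<int>"
  using assms(4)
proof (induction n arbitrary: h)
  case 0
  then show ?case by (simp add: int_coeffs_def)
next
  case (Suc n)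
  have "fact (Suc n) * fps_nth (h oo \<phi>) (Suc n) = fact n * fps_nth (fps_deriv (h oo \<phi>)) n"
    by (simp add: algebra_simps)
  also have "fps_deriv (h oo \<phi>) = (fps_deriv h * g) oo \<phi>"
    using assms(1,2) by (simp add: fps_compose_deriv fps_compose_mult_distrib)
  also have "fact n * fps_nth ((fps_deriv h * g) oo \<phi>) n \<in> \<int>"
    by (intro Suc.IH int_coeffs_mult int_coeffs_deriv Suc.prems assms)
  finally show ?case .
qed

context
  fixes a b :: int
  assumes ab: "a > 0" "b > 0"
begin

private abbreviation (input) "A \<equiv> fps_const (of_int a :: real)"
private abbreviation (input) "B \<equiv> fps_const (of_int b :: real)"

private definition W :: "real fps" where
  "W = fps_const (1 / (of_int a + of_int b)) *
     (A * inverse (1 - (A * fps_X)^2) + B * inverse (1 - (B * fps_X)^2))"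

private lemma Qm_eq: "Qm_fps a b = (1 - A * fps_X) * (1 - B * fps_X)"
  by (simp add: Qm_fps_def Q_fps_def fps_compose_mult_distrib fps_compose_add_distrib)

private lemma inverse_sq_nth:
  "fps_nth (inverse (1 - (fps_const x * fps_X)^2)) n = (if even n then x ^ n else (0::real))"
proof -
  let ?E = "Abs_fps (\<lambda>n. if even n then x ^ n else (0::real))"
  have "?E * (1 - (fps_const x * fps_X)^2) = 1"
  proof (rule fps_ext)
    fix n
    have "?E * (1 - (fps_const x * fps_X)^2) = ?E - fps_const (x^2) * (fps_X^2 * ?E)"
      by (simp add: algebra_simps power_mult_distrib fps_const_power)
    then have "fps_nth (?E * (1 - (fps_const x * fps_X)^2)) n =
        fps_nth ?E n - x^2 * (if n < 2 then 0 else fps_nth ?E (n - 2))"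
      by (simp only: fps_sub_nth fps_mult_left_const_nth fps_X_power_mult_nth)
    also have "\<dots> = fps_nth 1 n"
    proof (cases "n < 2")
      case True
      then show ?thesis by (auto dest: less_2_cases)
    next
      case False
      then have "n = Suc (Suc (n - 2))" by simp
      then obtain m where "n = Suc (Suc m)" ..
      then show ?thesis by (simp add: power2_eq_square)
    qed
    finally show "fps_nth (?E * (1 - (fps_const x * fps_X)^2)) n = fps_nth 1 n" .
  qed
  then have "inverse (1 - (fps_const x * fps_X)^2) = ?E"
    by (intro fps_inverse_unique) (simp only: mult.commute)
  then show ?thesis by simp
qed

private lemma W_nth: "fps_nth W n =
    (if even n then (of_int a ^ Suc n + of_int b ^ Suc n) / (of_int a + of_int b) else 0)"
  by (simp add: W_def inverse_sq_nth)

private lemma W_0: "fps_nth W 0 = 1"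
  using ab by (simp add: W_nth)

private lemma W_int: "int_coeffs W"
  unfolding int_coeffs_def
proof
  fix n
  show "fps_nth W n \<in> \<int>"
  proof (cases "even n")
    case True
    have "a - (-b) dvd a ^ Suc n - (-b) ^ Suc n"
      by (subst power_diff_sumr2) simp
    then have "a + b dvd a ^ Suc n + b ^ Suc n" using True by simp
    then obtain k where "a ^ Suc n + b ^ Suc n = (a + b) * k" by blast
    then have "(of_int a ^ Suc n + of_int b ^ Suc n :: real) = (of_int a + of_int b) * of_int k"
      by (metis of_int_add of_int_mult of_int_power)
    then have "fps_nth W n = of_int k" using True ab by (simp add: W_nth field_simps)
    then show ?thesis by simp
  qed (simp add: W_nth)
qed

private lemma f_deriv: "fps_deriv (f_fps a b) = W"
proof -
  define s where "s = (of_int a + of_int b :: real)"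
  have s: "s > 0" using ab by (simp add: s_def)
  define P where "P = Q_fps a b"
  define M where "M = Qm_fps a b"
  define G where "G = P / M"
  have P0: "fps_nth P 0 = 1" by (simp add: P_def Q_fps_def)
  have M0: "fps_nth M 0 = 1" by (simp add: M_def Qm_eq)
  have GM: "G * M = P"
    unfolding G_def using M0 by (simp add: fps_divide_unit mult.assoc inverse_mult_eq_1)
  have G0: "fps_nth G 0 = 1" using GM M0 P0 by (metis fps_mult_nth_0 mult.right_neutral)
  have "fps_deriv (fps_log G) = inverse G * fps_deriv G"
  proof -
    have "fps_deriv (fps_log G) = (inverse (1 + fps_X) oo (G - 1)) * fps_deriv (G - 1)"
      unfolding fps_log_def using G0 by (subst fps_compose_deriv) (auto simp: fps_ln_deriv)
    also have "inverse (1 + fps_X) oo (G - 1) = inverse ((1 + fps_X) oo (G - 1))"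
      using G0 by (intro fps_inverse_compose) auto
    also have "(1 + fps_X) oo (G - 1) = G" using G0 by (simp add: fps_compose_add_distrib)
    finally show ?thesis by simp
  qed
  then have f': "fps_deriv (f_fps a b) = fps_const (1 / (2 * s)) * (inverse G * fps_deriv G)"
    by (simp add: f_fps_def s_def G_def P_def M_def)
  have iG: "inverse G * G = 1" using G0 by (simp add: inverse_mult_eq_1)
  have dG: "fps_deriv G * M + G * fps_deriv M = fps_deriv P"
    by (simp add: GM[symmetric] algebra_simps)
  have "fps_deriv (f_fps a b) * (P * M) =
      fps_const (1 / (2 * s)) * ((inverse G * G) * (fps_deriv G * M) * M)"
    unfolding f' GM[symmetric] by (simp add: algebra_simps)
  also have "\<dots> = fps_const (1 / (2 * s)) * (fps_deriv P * M - P * fps_deriv M)"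
    unfolding iG dG[symmetric] GM[symmetric] by (simp add: algebra_simps)
  also have "fps_deriv P * M - P * fps_deriv M =
      fps_const 2 * (A * (1 - (B * fps_X)^2) + B * (1 - (A * fps_X)^2))"
    unfolding P_def M_def Qm_eq Q_fps_def
    by (simp add: algebra_simps power2_eq_square numeral_fps_const flip: mult_2)
  finally have 1: "fps_deriv (f_fps a b) * (P * M) =
      fps_const (1 / s) * (A * (1 - (B * fps_X)^2) + B * (1 - (A * fps_X)^2))"
    by (simp flip: mult.assoc)
  have PM: "P * M = (1 - (A * fps_X)^2) * (1 - (B * fps_X)^2)"
    unfolding P_def M_def Qm_eq Q_fps_def by (simp add: algebra_simps power2_eq_square)
  have iA: "inverse (1 - (A * fps_X)^2) * (1 - (A * fps_X)^2) = 1"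
    by (intro inverse_mult_eq_1) (simp add: power2_eq_square)
  have iB: "inverse (1 - (B * fps_X)^2) * (1 - (B * fps_X)^2) = 1"
    by (intro inverse_mult_eq_1) (simp add: power2_eq_square)
  have "W * (P * M) = fps_const (1 / s) *
      (A * (inverse (1 - (A * fps_X)^2) * (1 - (A * fps_X)^2)) * (1 - (B * fps_X)^2) +
       B * (inverse (1 - (B * fps_X)^2) * (1 - (B * fps_X)^2)) * (1 - (A * fps_X)^2))"
    unfolding W_def PM s_def[symmetric] by (simp only: algebra_simps)
  then have 2: "W * (P * M) =
      fps_const (1 / s) * (A * (1 - (B * fps_X)^2) + B * (1 - (A * fps_X)^2))"
    unfolding iA iB by simp
  have "P * M \<noteq> 0" using P0 M0 by (metis fps_mult_nth_0 fps_zero_nth mult_1 zero_neq_one)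
  then show ?thesis using 1 2 by (metis mult_right_cancel)
qed

private lemma f_0: "fps_nth (f_fps a b) 0 = 0"
  by (simp add: f_fps_def fps_log_def)

private lemma f_1: "fps_nth (f_fps a b) 1 = 1"
  using f_deriv W_0 by (metis One_nat_def Suc_eq_plus1 add_0 fps_deriv_nth mult_1 of_nat_1)

private lemma fbar_0: "fps_nth (fbar a b) 0 = 0"
  by (simp add: fps_inv_def)

private lemma fbar_deriv: "fps_deriv (fbar a b) = inverse W oo fbar a b"
proof -
  have "fps_deriv (fbar a b) = inverse (fps_deriv (f_fps a b) oo fbar a b)"
    using f_0 f_1 by (intro fps_inv_deriv) auto
  also have "\<dots> = inverse W oo fbar a b"
    unfolding f_deriv using W_0 fbar_0 by (intro fps_inverse_compose[symmetric]) auto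
  finally show ?thesis .
qed

private lemma c_fps_eq:
  "c_fps a b = (A * inverse (1 + A * fps_X) + B * inverse (1 + B * fps_X)) oo fbar a b"
  using fbar_0
  by (simp add: c_fps_def fps_compose_add_distrib fps_compose_mult_distrib fps_inverse_compose
      fps_divide_unit)

private lemma r_fps_eq: "r_fps a b = W oo fbar a b"
  using fbar_0
  by (simp add: r_fps_def W_def fps_compose_add_distrib fps_compose_mult_distrib
      fps_inverse_compose fps_divide_unit fps_compose_sub_distrib power2_eq_square)

private lemma fact_c: "fact n * fps_nth (c_fps a b) n \<in> \<int>"
proof -
  have lin: "int_coeffs (fps_const (of_int x) * inverse (1 + fps_const (of_int x) * fps_X))" for x
    by (intro int_coeffs_mult int_coeffs_inverse) (auto simp: int_coeffs_def fps_X_def)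
  show ?thesis
    unfolding c_fps_eq
    by (rule fact_compose_Ints[OF fbar_0 fbar_deriv int_coeffs_inverse[OF W_int W_0]])
       (intro int_coeffs_add lin)
qed

private lemma fact_r: "fact n * fps_nth (r_fps a b) n \<in> \<int>"
  unfolding r_fps_eq
  by (rule fact_compose_Ints[OF fbar_0 fbar_deriv int_coeffs_inverse[OF W_int W_0] W_int])

private lemma fact_div: "j \<le> k \<Longrightarrow> fact k / fact j * x =
    of_nat (k choose j) * (fact (k - j) * (x::real))"
  by (simp add: binomial_fact)

lemma of_int_pcoeff:
  "of_int (pcoeff a b k j) =
     fact k / fact j * (cseq a b (int k - int j) + real j * rseq a b (int k - int j + 1))"
proof -
  have c: "fact k / fact j * cseq a b (int k - int j) \<in> \<int>"
  proof (cases "j \<le> k")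
    case True
    then have "nat (int k - int j) = k - j" by simp
    then show ?thesis
      using True fact_c[of "k - j"] by (simp add: cseq_def fact_div Ints_mult del: times_divide_eq_left)
  qed (simp add: cseq_def)
  have r: "fact k / fact j * (real j * rseq a b (int k - int j + 1)) \<in> \<int>"
  proof (cases j)
    case (Suc i)
    have *: "fact k / fact j * (real j * rseq a b (int k - int j + 1)) =
        fact k / fact i * rseq a b (int k - int i)"
    proof -
      have idx: "int k - int j + 1 = int k - int i" using Suc by simp
      show ?thesis
        unfolding idx unfolding Suc fact_Suc by (simp add: field_simps del: of_nat_Suc)
    qed
    show ?thesis
    proof (cases "i \<le> k")
      case True
      then have "nat (int k - int i) = k - i" by simp
      then show ?thesis
        unfolding * using True fact_r[of "k - i"]
        by (simp add: rseq_def fact_div Ints_mult del: times_divide_eq_left)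
    next
      case False
      then show ?thesis unfolding * by (simp add: rseq_def)
    qed
  qed simp
  have "fact k / fact j * (cseq a b (int k - int j) + real j * rseq a b (int k - int j + 1)) \<in> \<int>"
    using Ints_add[OF c r] by (simp only: distrib_left)
  then show ?thesis unfolding pcoeff_def by simp
qed

end

end

theory Submission
  imports Defs
begin

text \<open>
  Write \<open>s = a + b\<close>. Since \<open>Q(z)/Q(-z) = exp (2 s f(z))\<close>, the generating function of the
  \<open>H\<^sub>n(x)/n!\<close> is \<open>Q(-z) exp (2 s x f(z))\<close>. Replacing \<open>z\<close> by \<open>-z\<close> and using that \<open>f\<close> is odd, the
  coefficient of \<open>x\<^sup>k\<close> in \<open>H\<^sub>n\<close> is \<open>(-1)\<^bsup>n+k\<^esup> (2 s)\<^sup>k\<close> times the entry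
  \<open>n! [z\<^sup>n] Q(z) f(z)\<^sup>k/k!\<close> of an exponential Riordan array. The theorem says that the tree computes
  this array.

  The connection is the operator \<open>T g = c g + r g'\<close> on power series (called \<open>production\<close>).
  The series \<open>c\<close> and \<open>r\<close> are made for \<open>Q' = Q (c \<circ> f)\<close> and \<open>f' = r \<circ> f\<close>, whence \<open>(Q (g \<circ> f))' = Q (T g \<circ> f)\<close>
  (lemma \<open>deriv_Q_compose\<close>). Taking \<open>n\<close> derivatives and then the constant term gives
  \<open>n! [z\<^sup>n] Q (g \<circ> f) = [z\<^sup>0] T\<^sup>n g\<close>, because \<open>Q(0) = 1\<close> and \<open>f(0) = 0\<close>.

  On the other hand, the \<open>p\<^sub>k\<^sub>j\<close> are the matrix of \<open>T\<close> in the basis \<open>z\<^sup>j/j!\<close>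
  (lemma \<open>transfer_pcoeff\<close>). A marked node and its whole subtree count as the negative of the
  corresponding unmarked ones, so the difference of unmarked and marked nodes \<open>(j)\<close> at
  level \<open>n\<close> below a node \<open>(i)\<close> is the entry \<open>(i, j)\<close> of the \<open>n\<close>-th power of this matrix
  (lemma \<open>net_eq_funpow_transfer\<close>), that is, \<open>i! [z\<^sup>i] T\<^sup>n (z\<^sup>j/j!)\<close>. At the root \<open>i = 0\<close>, and both
  descriptions meet. The recursion for the tree splits it at the root, not at the
  last level: the matrix then multiplies from the left, which is how \<open>T\<close> acts on coefficients.
\<close>

section \<open>Signed node counts in marked generating trees\<close>

definition net :: "nat \<Rightarrow> nat \<Rightarrow> mlabel ltree \<Rightarrow> real" where
  "net n j t = of_nat (num_nodes n (Unmarked j) t) - of_nat (num_nodes n (Marked j) t)"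

fun signed :: "(nat \<Rightarrow> real) \<Rightarrow> mlabel \<Rightarrow> real" where
  "signed u (Unmarked i) = u i"
| "signed u (Marked i) = - u i"

definition transfer :: "(nat \<Rightarrow> nat \<Rightarrow> int) \<Rightarrow> (nat \<Rightarrow> real) \<Rightarrow> nat \<Rightarrow> real" where
  "transfer p u i = (\<Sum>k<i+2. of_int (p i k) * u k)"

lemma num_nodes_Suc: "num_nodes (Suc n) x t = sum_list (map (num_nodes n x) (children t))"
  by (simp add: num_nodes_def[abs_def] filter_concat length_concat comp_def)

lemma net_Suc: "net (Suc n) j t = sum_list (map (net n j) (children t))"
proof -
  have "of_nat (sum_list (map (num_nodes n x) ts)) =
      sum_list (map (\<lambda>t. of_nat (num_nodes n x t) :: real) ts)" for x :: mlabel and ts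
    by (induction ts) auto
  then show ?thesis
    by (simp add: net_def[abs_def] num_nodes_Suc sum_list_subtractf)
qed

lemma net_0: "net 0 j (gen_tree rule v) = signed (\<lambda>i. of_bool (i = j)) v"
  by (cases v) (auto simp: net_def num_nodes_def)

text \<open>The marks only encode signs: under \<open>signed\<close>, the convention for negative exponents
  turns a multiplicity into a scalar factor.\<close>

lemma signed_copies: "sum_list (map (signed u) (copies v p)) = of_int p * signed u v"
  by (cases v) (auto simp: copies_def sum_list_replicate)

lemma signed_marked_rule:
  "sum_list (map (signed u) (marked_rule p v)) = signed (transfer p u) v"
proof -
  have "sum_list (map (signed u) (concat (map (\<lambda>j. copies (w j) (p i j)) [0..<m]))) =
      (\<Sum>j<m. of_int (p i j) * signed u (w j))" for w i and m :: nat
    by (induction m) (simp_all add: signed_copies)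
  then show ?thesis
    by (cases v) (simp_all only: marked_rule.simps signed.simps transfer_def
        sum_negf mult_minus_right)
qed

text \<open>By induction from the root: the subtrees below the children of \<open>v\<close> have signed counts given
  by \<open>n\<close> applications of the matrix, and the list of children applies it once more.\<close>

lemma net_eq_funpow_transfer:
  "net n j (gen_tree (marked_rule p) v) = signed ((transfer p ^^ n) (\<lambda>i. of_bool (i = j))) v"
proof (induction n arbitrary: v)
  case 0
  then show ?case by (simp only: net_0 funpow_0)
next
  case (Suc n)
  have "net (Suc n) j (gen_tree (marked_rule p) v) =
      sum_list (map (\<lambda>w. net n j (gen_tree (marked_rule p) w)) (marked_rule p v))"
    by (simp add: net_Suc comp_def)
  then show ?case
    by (simp add: Suc.IH signed_marked_rule)
qed

section \<open>Logarithmic derivatives of power series\<close>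

text \<open>Powers, logarithms, products and quotients of \<open>Q\<close> are all handled through logarithmic
  derivatives: \<open>g\<close> is the logarithmic derivative of \<open>F\<close> when \<open>F' = g F\<close>. The next lemma
  recovers a series from this equation: the coefficient of \<open>z\<^sup>n\<close> in \<open>F'\<close> determines that of
  \<open>z\<^bsup>n+1\<^esup>\<close> in \<open>F\<close>, while the right-hand side only involves lower ones.\<close>

lemma fps_linear_ODE_unique:
  fixes F G g :: "real fps"
  assumes "fps_deriv F = g * F" "fps_deriv G = g * G" "fps_nth F 0 = fps_nth G 0"
  shows "F = G"
proof (rule fps_ext)
  fix n
  show "fps_nth F n = fps_nth G n"
  proof (induction n rule: less_induct)
    case (less n)
    show ?case
    proof (cases n)
      case (Suc m)
      have "fps_nth (fps_deriv F) m = fps_nth (fps_deriv G) m"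
        unfolding assms(1,2) fps_mult_nth using less Suc by (intro sum.cong) auto
      then show ?thesis using Suc by (simp del: of_nat_Suc)
    qed (use assms(3) in simp)
  qed
qed

lemma inverse_1_plus_X_compose:
  fixes F :: "real fps"
  assumes "fps_nth F 0 = 1"
  shows "inverse (1 + fps_X) oo (F - 1) = inverse F"
proof -
  have "(1 + fps_X) oo (F - 1) = F"
    using assms by (simp add: fps_compose_add_distrib)
  then show ?thesis
    using assms by (subst fps_inverse_compose) auto
qed

lemma fps_pow_nth_0: "fps_nth (fps_pow F x) 0 = 1"
  by (simp add: fps_pow_def)

lemma fps_pow_deriv:
  assumes "fps_nth F 0 = 1" "fps_deriv F = g * F"
  shows "fps_deriv (fps_pow F x) = (fps_const x * g) * fps_pow F x"
proof -
  have F: "inverse F * F = 1" using assms(1) by (simp add: inverse_mult_eq_1)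
  have "fps_deriv (fps_pow F x) = (fps_const x * fps_pow F x * inverse F) * fps_deriv F"
    using assms(1)
    by (simp add: fps_pow_def fps_compose_deriv inverse_1_plus_X_compose fps_binomial_deriv
        fps_divide_unit fps_compose_mult_distrib)
  also have "\<dots> = fps_const x * fps_pow F x * g * (inverse F * F)"
    unfolding assms(2) by (simp only: mult_ac)
  finally show ?thesis unfolding F by (simp only: mult_ac mult_1_left)
qed

lemma fps_log_deriv:
  assumes "fps_nth F 0 = 1" "fps_deriv F = g * F"
  shows "fps_deriv (fps_log F) = g"
proof -
  have F: "inverse F * F = 1" using assms(1) by (simp add: inverse_mult_eq_1)
  have "fps_deriv (fps_log F) = inverse F * fps_deriv F"
    using assms(1) by (simp add: fps_log_def fps_compose_deriv fps_ln_deriv inverse_1_plus_X_compose)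
  also have "\<dots> = g * (inverse F * F)"
    unfolding assms(2) by (simp only: mult_ac)
  finally show ?thesis unfolding F by simp
qed

lemma fps_log_deriv_mult:
  fixes F G g h :: "real fps"
  assumes "fps_deriv F = g * F" "fps_deriv G = h * G"
  shows "fps_deriv (F * G) = (g + h) * (F * G)"
  using assms by (simp add: algebra_simps)

lemma fps_log_deriv_divide:
  fixes F G g h :: "real fps"
  assumes "fps_deriv F = g * F" "fps_deriv G = h * G" "fps_nth G 0 \<noteq> 0"
  shows "fps_deriv (F / G) = (g - h) * (F / G)"
proof -
  have G: "inverse G * G = 1" using assms(3) by (simp add: inverse_mult_eq_1)
  have "fps_deriv (inverse G) = - h * inverse G * (inverse G * G)"
    using assms(2,3) by (simp add: fps_inverse_deriv power2_eq_square algebra_simps)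
  then have "fps_deriv (inverse G) = - h * inverse G" unfolding G by simp
  from fps_log_deriv_mult[OF assms(1) this] show ?thesis
    using assms(3) by (simp only: fps_divide_unit[OF assms(3)] diff_conv_add_uminus)
qed

lemma fps_mult_compose_nth:
  fixes f g G :: "real fps"
  assumes "fps_nth f 0 = 0"
  shows "fps_nth (G * (g oo f)) n = (\<Sum>k=0..n. fps_nth g k * fps_nth (G * f ^ k) n)"
proof -
  have g: "fps_nth (g oo f) i = (\<Sum>k=0..n. fps_nth g k * fps_nth (f ^ k) i)" if "i \<le> n" for i
    unfolding fps_compose_nth using that assms
    by (intro sum.mono_neutral_left) (auto simp: startsby_zero_power_prefix)
  have "fps_nth (G * (g oo f)) n =
      (\<Sum>i=0..n. \<Sum>k=0..n. fps_nth g k * (fps_nth G i * fps_nth (f ^ k) (n - i)))"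
    unfolding fps_mult_nth by (intro sum.cong) (simp_all add: g sum_distrib_left mult_ac)
  also have "\<dots> = (\<Sum>k=0..n. fps_nth g k * fps_nth (G * f ^ k) n)"
    by (subst sum.swap) (simp add: fps_mult_nth sum_distrib_left)
  finally show ?thesis .
qed

section \<open>The series \<open>Q\<close> and \<open>f\<close>\<close>

text \<open>The logarithmic derivative of \<open>1 + u z\<close>.\<close>

definition dlog_lin :: "int \<Rightarrow> real fps" where
  "dlog_lin u = fps_const (of_int u) * inverse (1 + fps_const (of_int u) * fps_X)"

definition dlog_Q :: "int \<Rightarrow> int \<Rightarrow> real fps" where
  "dlog_Q a b = dlog_lin a + dlog_lin b"

lemma Q_nth_0: "fps_nth (Q_fps a b) 0 = 1"
  by (simp add: Q_fps_def)

lemma Qm_eq_Q_uminus: "Qm_fps a b = Q_fps (- a) (- b)"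
  by (simp add: Qm_fps_def Q_fps_def fps_compose_mult_distrib fps_compose_add_distrib
      flip: fps_const_neg)

lemma Q_deriv: "fps_deriv (Q_fps a b) = dlog_Q a b * Q_fps a b"
proof -
  have "fps_deriv (1 + fps_const (of_int u) * fps_X :: real fps) =
      dlog_lin u * (1 + fps_const (of_int u) * fps_X)" for u
    unfolding dlog_lin_def mult.assoc by (subst inverse_mult_eq_1) simp_all
  from fps_log_deriv_mult[OF this this] show ?thesis
    unfolding Q_fps_def dlog_Q_def .
qed

lemma dlog_lin_compose_uminus: "dlog_lin u oo (- fps_X) = - dlog_lin (- u)"
proof -
  have "(1 + fps_const (of_int u) * fps_X) oo (- fps_X) =
      (1 + fps_const (of_int (- u)) * fps_X :: real fps)"
    by (simp add: fps_compose_mult_distrib fps_compose_add_distrib flip: fps_const_neg)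
  then have "inverse (1 + fps_const (of_int u) * fps_X) oo (- fps_X) =
      inverse (1 + fps_const (of_int (- u)) * fps_X :: real fps)"
    by (subst fps_inverse_compose) auto
  then show ?thesis
    by (simp add: dlog_lin_def fps_compose_mult_distrib flip: fps_const_neg)
qed

lemma dlog_lin_diff:
  "dlog_lin u - dlog_lin (- u) =
    fps_const (2 * of_int u) * inverse (1 - (fps_const (of_int u) * fps_X)^2)"
proof -
  define U :: "real fps" where "U = fps_const (of_int u)"
  define P where "P = 1 + U * fps_X"
  define N where "N = 1 - U * fps_X"
  have P: "inverse P * P = 1" and N: "inverse N * N = 1"
    by (simp_all add: P_def N_def inverse_mult_eq_1)
  have PN: "1 - (U * fps_X)^2 = P * N" and sum: "N + P = 2"
    by (simp_all add: P_def N_def algebra_simps power2_eq_square)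
  have "dlog_lin u - dlog_lin (- u) = U * inverse P + U * inverse N"
    by (simp add: dlog_lin_def U_def P_def N_def flip: fps_const_neg)
  also have "\<dots> = U * (inverse P * (inverse N * N) + inverse N * (inverse P * P))"
    unfolding P N by (simp add: distrib_left)
  also have "\<dots> = U * (N + P) * inverse (P * N)"
    unfolding fps_inverse_mult by (simp only: algebra_simps)
  also have "U * (N + P) = fps_const (2 * of_int u)"
    unfolding sum U_def by (simp add: numeral_fps_const mult.commute)
  finally show ?thesis unfolding PN[symmetric] U_def .
qed

lemma f_nth_0: "fps_nth (f_fps a b) 0 = 0"
  by (simp add: f_fps_def fps_log_def)

lemma f_deriv:
  "fps_deriv (f_fps a b) =
    fps_const (1 / (2 * (of_int a + of_int b))) * (dlog_Q a b - dlog_Q (- a) (- b))"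
proof -
  have "fps_deriv (Q_fps a b / Qm_fps a b) =
      (dlog_Q a b - dlog_Q (- a) (- b)) * (Q_fps a b / Qm_fps a b)"
    by (intro fps_log_deriv_divide) (simp_all add: Qm_eq_Q_uminus Q_deriv Q_nth_0)
  then have "fps_deriv (fps_log (Q_fps a b / Qm_fps a b)) = dlog_Q a b - dlog_Q (- a) (- b)"
    by (intro fps_log_deriv) (simp_all add: Qm_eq_Q_uminus Q_nth_0 fps_divide_unit)
  then show ?thesis by (simp add: f_fps_def)
qed

lemma f_nth_1:
  assumes "a + b \<noteq> 0"
  shows "fps_nth (f_fps a b) 1 = 1"
proof -
  define s :: real where "s = of_int a + of_int b"
  have s: "s \<noteq> 0" using assms by (simp add: s_def flip: of_int_add)
  have "fps_nth (f_fps a b) 1 = fps_nth (fps_deriv (f_fps a b)) 0" by simp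
  also have "\<dots> = 1 / (2 * s) * (2 * s)"
    unfolding f_deriv by (simp add: dlog_Q_def dlog_lin_def s_def)
  finally show ?thesis using s by simp
qed

text \<open>Substituting \<open>-z\<close> exchanges numerator and denominator under the logarithm; at the level of
  derivatives, \<open>f'\<close> is even.\<close>

lemma f_odd: "f_fps a b oo (- fps_X) = - f_fps a b"
proof -
  have "fps_deriv (f_fps a b oo (- fps_X)) = - (fps_deriv (f_fps a b) oo (- fps_X))"
    by (subst fps_compose_deriv) simp_all
  also have "fps_deriv (f_fps a b) oo (- fps_X) = fps_deriv (f_fps a b)"
    unfolding f_deriv dlog_Q_def
    by (simp add: fps_compose_mult_distrib fps_compose_add_distrib fps_compose_sub_distrib
        dlog_lin_compose_uminus)
  finally have "fps_deriv (f_fps a b oo (- fps_X)) = fps_deriv (- f_fps a b)" by simp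
  then show ?thesis
    by (subst (asm) fps_deriv_eq_iff) (simp add: f_nth_0)
qed

lemma fbar_compose_f:
  assumes "a + b \<noteq> 0"
  shows "fbar a b oo f_fps a b = fps_X"
  using f_nth_0 f_nth_1[OF assms] by (intro fps_inv) auto

lemma fbar_nth_0: "fps_nth (fbar a b) 0 = 0"
  by (simp add: fps_inv_def)

text \<open>The series \<open>c\<close> and \<open>r\<close> arise from the rational functions \<open>Q'/Q\<close> and \<open>f'\<close> by putting the
  inverse of \<open>f\<close> for the variable, so composing with \<open>f\<close> gives these functions back.\<close>

lemma c_compose_f:
  assumes "a + b \<noteq> 0"
  shows "c_fps a b oo f_fps a b = dlog_Q a b"
  using fbar_compose_f[OF assms]
  by (simp add: c_fps_def dlog_Q_def dlog_lin_def fbar_nth_0 f_nth_0 fps_divide_unit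
      fps_compose_add_distrib fps_compose_mult_distrib fps_inverse_compose)

lemma r_compose_f:
  assumes "a + b \<noteq> 0"
  shows "r_fps a b oo f_fps a b = fps_deriv (f_fps a b)"
proof -
  define s :: real where "s = of_int a + of_int b"
  define V :: "int \<Rightarrow> real fps" where
    "V u = inverse (1 - (fps_const (of_int u) * fps_X)^2)" for u
  have "r_fps a b oo f_fps a b =
      fps_const (1 / s) * (fps_const (of_int a) * V a + fps_const (of_int b) * V b)"
    using fbar_compose_f[OF assms]
    by (simp add: r_fps_def s_def V_def fbar_nth_0 f_nth_0 fps_divide_unit power2_eq_square
        fps_compose_add_distrib fps_compose_sub_distrib fps_compose_mult_distrib
        fps_inverse_compose)
  also have "\<dots> = fps_const (1 / (2 * s)) *
      (fps_const (2 * of_int a) * V a + fps_const (2 * of_int b) * V b)"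
    by (simp add: distrib_left flip: mult.assoc)
  also have "\<dots> = fps_deriv (f_fps a b)"
    unfolding f_deriv s_def V_def dlog_Q_def dlog_lin_diff[symmetric] by (simp add: algebra_simps)
  finally show ?thesis .
qed

section \<open>The production operator\<close>

definition production :: "int \<Rightarrow> int \<Rightarrow> real fps \<Rightarrow> real fps" where
  "production a b g = c_fps a b * g + r_fps a b * fps_deriv g"

text \<open>Product and chain rule, with \<open>Q' = Q (c \<circ> f)\<close> and \<open>f' = r \<circ> f\<close>: series of the form
  \<open>Q (g \<circ> f)\<close> are closed under differentiation, which acts on \<open>g\<close> alone.\<close>

lemma deriv_Q_compose:
  assumes "a + b \<noteq> 0"
  shows "fps_deriv (Q_fps a b * (g oo f_fps a b)) =
    Q_fps a b * (production a b g oo f_fps a b)"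
  by (simp add: production_def Q_deriv fps_compose_deriv f_nth_0 fps_compose_add_distrib
      fps_compose_mult_distrib c_compose_f[OF assms] r_compose_f[OF assms] algebra_simps)

lemma Q_compose_nth:
  assumes "a + b \<noteq> 0"
  shows "fact n * fps_nth (Q_fps a b * (g oo f_fps a b)) n = fps_nth ((production a b ^^ n) g) 0"
proof -
  have "(fps_deriv ^^ n) (Q_fps a b * (g oo f_fps a b)) =
      Q_fps a b * ((production a b ^^ n) g oo f_fps a b)"
    by (induction n) (simp_all add: deriv_Q_compose[OF assms] del: fps_deriv_mult)
  then show ?thesis
    by (simp add: Q_nth_0 flip: fps_0th_higher_deriv)
qed

text \<open>In the basis \<open>z\<^sup>k/k!\<close>, the entry \<open>(i, k)\<close> of the matrix of \<open>T\<close> is \<open>i!/k!\<close> times the sum of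
  \<open>c\<^bsub>i-k\<^esub>\<close>, from the term \<open>c g\<close>, and \<open>k r\<^bsub>i-k+1\<^esub>\<close>, from the term \<open>r g'\<close>. The ranges differ: \<open>k \<le> i\<close> for the first and
  \<open>1 \<le> k \<le> i + 1\<close> for the second, where the convention for negative indices and the factor \<open>k\<close>
  fill the gaps.\<close>

lemma transfer_pcoeff:
  assumes "a > 0" "b > 0"
  shows "transfer (pcoeff a b) (\<lambda>k. fact k * fps_nth g k) i =
    fact i * fps_nth (production a b g) i"
proof -
  have entry: "of_int (pcoeff a b i k) * (fact k * fps_nth g k) =
      fact i * (cseq a b (int i - int k) * fps_nth g k) +
      fact i * (real k * rseq a b (int i - int k + 1) * fps_nth g k)" for k
    unfolding of_int_pcoeff[OF assms] by (simp add: field_simps)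
  have "(\<Sum>k<i+2. cseq a b (int i - int k) * fps_nth g k) =
      (\<Sum>k=0..i. cseq a b (int i - int k) * fps_nth g k)"
    by (intro sum.mono_neutral_right) (auto simp: cseq_def)
  also have "\<dots> = (\<Sum>k=0..i. fps_nth g k * fps_nth (c_fps a b) (i - k))"
    by (intro sum.cong) (auto simp: cseq_def nat_diff_distrib mult.commute)
  also have "\<dots> = fps_nth (c_fps a b * g) i"
    by (simp add: fps_mult_nth mult.commute[of "c_fps a b"])
  finally have c: "(\<Sum>k<i+2. cseq a b (int i - int k) * fps_nth g k) =
      fps_nth (c_fps a b * g) i" .
  have "(\<Sum>k<i+2. real k * rseq a b (int i - int k + 1) * fps_nth g k) =
      (\<Sum>k<Suc i. real (Suc k) * rseq a b (int i - int k) * fps_nth g (Suc k))"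
    by (subst add_2_eq_Suc', subst sum.lessThan_Suc_shift) simp
  also have "\<dots> = (\<Sum>k=0..i. fps_nth (fps_deriv g) k * fps_nth (r_fps a b) (i - k))"
    by (intro sum.cong) (auto simp: rseq_def nat_diff_distrib mult_ac)
  also have "\<dots> = fps_nth (r_fps a b * fps_deriv g) i"
    by (simp only: fps_mult_nth mult.commute[of "r_fps a b"])
  finally have r: "(\<Sum>k<i+2. real k * rseq a b (int i - int k + 1) * fps_nth g k) =
      fps_nth (r_fps a b * fps_deriv g) i" .
  show ?thesis
    unfolding transfer_def entry sum.distrib sum_distrib_left[symmetric] c r
    by (simp add: production_def distrib_left)
qed

lemma net_marked_tree:
  assumes "a > 0" "b > 0"
  shows "net n k (marked_tree (pcoeff a b)) =
    fps_nth ((production a b ^^ n) (fps_const (1 / fact k) * fps_X ^ k)) 0"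
proof -
  have "(transfer (pcoeff a b) ^^ n) (\<lambda>i. of_bool (i = k)) =
      (\<lambda>i. fact i * fps_nth ((production a b ^^ n) (fps_const (1 / fact k) * fps_X ^ k)) i)"
  proof (induction n)
    case 0
    then show ?case by (auto simp: fun_eq_iff)
  next
    case (Suc n)
    show ?case by (simp add: Suc.IH transfer_pcoeff[OF assms])
  qed
  then show ?thesis by (simp add: marked_tree_def net_eq_funpow_transfer)
qed

section \<open>The coefficients of the polynomials \<open>H\<^sub>n\<close>\<close>

text \<open>Both sides have constant term \<open>1\<close> and the logarithmic derivative
  \<open>x Q'/Q + (1 - x) Q\<^sub>-'/Q\<^sub>- = Q\<^sub>-'/Q\<^sub>- + 2 s x f'\<close>, where \<open>Q\<^sub>-(z) = Q(-z)\<close>.\<close>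

lemma H_gf_eq_exp:
  assumes "a + b \<noteq> 0"
  shows "fps_pow (Q_fps a b) x * fps_pow (Qm_fps a b) (1 - x) =
    Qm_fps a b * (fps_exp (2 * (of_int a + of_int b) * x) oo f_fps a b)"
proof (rule fps_linear_ODE_unique)
  define s :: real where "s = of_int a + of_int b"
  have s: "s \<noteq> 0" using assms by (simp add: s_def flip: of_int_add)
  let ?P = "dlog_Q a b" and ?M = "dlog_Q (- a) (- b)"
  let ?g = "fps_const x * ?P + fps_const (1 - x) * ?M"
  show "fps_deriv (fps_pow (Q_fps a b) x * fps_pow (Qm_fps a b) (1 - x)) =
      ?g * (fps_pow (Q_fps a b) x * fps_pow (Qm_fps a b) (1 - x))"
    by (intro fps_log_deriv_mult fps_pow_deriv) (simp_all add: Qm_eq_Q_uminus Q_deriv Q_nth_0)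
  have "fps_const (2 * s * x) * fps_deriv (f_fps a b) = fps_const x * (?P - ?M)"
    unfolding f_deriv s_def[symmetric] using s by (simp flip: mult.assoc)
  then have "?g = ?M + fps_const (2 * s * x) * fps_deriv (f_fps a b)"
    by (simp add: algebra_simps flip: fps_const_sub)
  moreover have "fps_deriv (fps_exp (2 * s * x) oo f_fps a b) =
      (fps_const (2 * s * x) * fps_deriv (f_fps a b)) * (fps_exp (2 * s * x) oo f_fps a b)"
    by (simp add: fps_compose_deriv f_nth_0 fps_compose_mult_distrib)
  ultimately show "fps_deriv (Qm_fps a b *
        (fps_exp (2 * (of_int a + of_int b) * x) oo f_fps a b)) =
      ?g * (Qm_fps a b * (fps_exp (2 * (of_int a + of_int b) * x) oo f_fps a b))"
    unfolding s_def[symmetric]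
    by (metis fps_log_deriv_mult Q_deriv Qm_eq_Q_uminus)
qed (simp add: fps_pow_nth_0 Qm_eq_Q_uminus Q_nth_0)

text \<open>As \<open>f\<close> is odd, \<open>Q(-z) f(z)\<^sup>k\<close> is \<open>(-1)\<^sup>k Q(z) f(z)\<^sup>k\<close> at \<open>-z\<close>. This is where the sign
  of the theorem comes from.\<close>

lemma Qm_f_power_nth:
  "fps_nth (Qm_fps a b * f_fps a b ^ k) n =
    (-1) ^ (n + k) * fps_nth (Q_fps a b * f_fps a b ^ k) n"
proof -
  have "((- f_fps a b) ^ k) oo (- fps_X) = ((- f_fps a b) oo (- fps_X)) ^ k"
    by (rule fps_compose_power[symmetric]) simp
  also have "\<dots> = f_fps a b ^ k"
    by (simp add: fps_compose_uminus f_odd)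
  finally have "Qm_fps a b * f_fps a b ^ k = (Q_fps a b * (- f_fps a b) ^ k) oo (- fps_X)"
    by (subst fps_compose_mult_distrib) (simp_all add: Qm_fps_def)
  then have "fps_nth (Qm_fps a b * f_fps a b ^ k) n =
      (-1) ^ n * fps_nth (Q_fps a b * (- f_fps a b) ^ k) n"
    by (simp add: fps_compose_uminus')
  also have "Q_fps a b * (- f_fps a b) ^ k = fps_const ((-1) ^ k) * (Q_fps a b * f_fps a b ^ k)"
    by (cases "even k") (simp_all flip: fps_const_neg)
  finally show ?thesis by (simp add: power_add)
qed

text \<open>Expanding the exponential writes \<open>H\<^sub>n(x)/n!\<close> as a finite sum of powers of \<open>x\<close>, since
  \<open>f(z)\<^sup>k\<close> starts at \<open>z\<^sup>k\<close>. As this holds for every real \<open>x\<close>, it is an identity of polynomials.\<close>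

lemma H_coeff:
  fixes H :: "nat \<Rightarrow> real poly"
  assumes "a + b \<noteq> 0"
    and H: "\<And>x::real. Abs_fps (\<lambda>m. poly (H m) x / fact m) =
              fps_pow (Q_fps a b) x * fps_pow (Qm_fps a b) (1 - x)"
    and "k \<le> n"
  shows "coeff (H n) k =
    (2 * (of_int a + of_int b)) ^ k / fact k * fact n * fps_nth (Qm_fps a b * f_fps a b ^ k) n"
proof -
  let ?h = "\<lambda>k. (2 * (of_int a + of_int b)) ^ k / fact k * fact n *
    fps_nth (Qm_fps a b * f_fps a b ^ k) n"
  have "poly (H n) x = poly (\<Sum>k=0..n. monom (?h k) k) x" for x
  proof -
    have "poly (H n) x / fact n =
        fps_nth (Qm_fps a b * (fps_exp (2 * (of_int a + of_int b) * x) oo f_fps a b)) n"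
      using arg_cong[OF H[of x], of "\<lambda>F. fps_nth F n"] H_gf_eq_exp[OF assms(1)] by simp
    also have "\<dots> = (\<Sum>k=0..n. (2 * (of_int a + of_int b) * x) ^ k / fact k *
        fps_nth (Qm_fps a b * f_fps a b ^ k) n)"
      by (simp add: fps_mult_compose_nth f_nth_0)
    finally have "poly (H n) x = (\<Sum>k=0..n. (2 * (of_int a + of_int b) * x) ^ k / fact k *
        fps_nth (Qm_fps a b * f_fps a b ^ k) n) * fact n"
      by (simp add: field_simps)
    also have "\<dots> = (\<Sum>k=0..n. ?h k * x ^ k)"
      unfolding sum_distrib_right
      by (intro sum.cong) (simp_all add: power_mult_distrib)
    finally show ?thesis by (simp add: poly_sum poly_monom)
  qed
  then have "H n = (\<Sum>k=0..n. monom (?h k) k)"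
    by (intro poly_ext)
  then show ?thesis
    using \<open>k \<le> n\<close> by (simp add: coeff_sum)
qed

theorem theorem3:
  fixes a b :: int and H :: "nat \<Rightarrow> real poly" and n k :: nat
  assumes "a > 0" and "b > 0"
    and H: "\<And>x::real. Abs_fps (\<lambda>m. poly (H m) x / fact m) =
              fps_pow (Q_fps a b) x * fps_pow (Qm_fps a b) (1 - x)"
    and "k \<le> n"
  shows "coeff (H n) k = (-1) ^ (n + k) * of_int (2 * a + 2 * b) ^ k *
           (of_nat (num_nodes n (Unmarked k) (marked_tree (pcoeff a b)))
            - of_nat (num_nodes n (Marked k) (marked_tree (pcoeff a b))))"
proof -
  have ab: "a + b \<noteq> 0" using assms by simp
  let ?E = "fps_const (1 / fact k) * fps_X ^ k :: real fps"
  have "?E oo f_fps a b = fps_const (1 / fact k) * f_fps a b ^ k"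
    by (simp add: fps_compose_mult_distrib fps_compose_power[symmetric] f_nth_0)
  then have E: "Q_fps a b * (?E oo f_fps a b) = fps_const (1 / fact k) * (Q_fps a b * f_fps a b ^ k)"
    by (simp only: mult_ac)
  have "coeff (H n) k = (-1) ^ (n + k) * of_int (2 * a + 2 * b) ^ k *
      (fact n * fps_nth (Q_fps a b * (?E oo f_fps a b)) n)"
    unfolding H_coeff[OF ab H \<open>k \<le> n\<close>] Qm_f_power_nth E by simp
  also have "fact n * fps_nth (Q_fps a b * (?E oo f_fps a b)) n =
      net n k (marked_tree (pcoeff a b))"
    unfolding Q_compose_nth[OF ab] net_marked_tree[OF assms(1,2)] ..
  finally show ?thesis unfolding net_def .
qed

end
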